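(* A group is residually finite if and only if it has a semi-conjugacy-separating family of finite-index subgroups.
   Context: A family $\sigma$ of finite-index subgroups of a group $G$ is separating if for any non-empty finite subset $F\subset G\setminus\{1\}$ there is $G_\alpha\in\sigma$ such that $g\notin G_\alpha$ for every $g\in F$. $G$ is residually finite if it has a separating family of finite-index subgroups (equivalently, the family of all its finite-index subgroups is separating). The family $\sigma$ is semi-conjugacy-separating if for every non-empty finite subset $F\subset G$ there is $G_\alpha\in\sigma$ such that $G_\alpha\cap g^G G_\alpha=\varnothing$ for every $g\in F\setminus\{1\}$, where $g^G$ is the conjugacy class of $g$. *)

theory Defs
  imports "HOL-Algebra.Coset"
begin

definition finite_index_subgroup :: "('a, 'b) monoid_scheme \<Rightarrow> 'a set \<Rightarrow> bool" where
  "finite_index_subgroup G H \<longleftrightarrow> subgroup H G \<and> finite (rcosets\<^bsub>G\<^esub> H)"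

definition conjugacy_class :: "('a, 'b) monoid_scheme \<Rightarrow> 'a \<Rightarrow> 'a set" where
  "conjugacy_class G g = {x \<otimes>\<^bsub>G\<^esub> g \<otimes>\<^bsub>G\<^esub> inv\<^bsub>G\<^esub> x | x. x \<in> carrier G}"

text \<open>Whether a family is (semi-conjugacy-)separating depends only on its set of members, so
  families are sets of subgroups.\<close>

definition finite_index_family :: "('a, 'b) monoid_scheme \<Rightarrow> 'a set set \<Rightarrow> bool" where
  "finite_index_family G \<sigma> \<longleftrightarrow> (\<forall>H\<in>\<sigma>. finite_index_subgroup G H)"

definition separating :: "('a, 'b) monoid_scheme \<Rightarrow> 'a set set \<Rightarrow> bool" where
  "separating G \<sigma> \<longleftrightarrow>
     (\<forall>F. F \<subseteq> carrier G - {\<one>\<^bsub>G\<^esub>} \<and> finite F \<and> F \<noteq> {} \<longrightarrow>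
       (\<exists>H\<in>\<sigma>. \<forall>g\<in>F. g \<notin> H))"

definition residually_finite :: "('a, 'b) monoid_scheme \<Rightarrow> bool" where
  "residually_finite G \<longleftrightarrow> (\<exists>\<sigma>. finite_index_family G \<sigma> \<and> separating G \<sigma>)"

definition semi_conjugacy_separating :: "('a, 'b) monoid_scheme \<Rightarrow> 'a set set \<Rightarrow> bool" where
  "semi_conjugacy_separating G \<sigma> \<longleftrightarrow>
     (\<forall>F. F \<subseteq> carrier G \<and> finite F \<and> F \<noteq> {} \<longrightarrow>
       (\<exists>H\<in>\<sigma>. \<forall>g\<in>F - {\<one>\<^bsub>G\<^esub>}. H \<inter> (conjugacy_class G g <#>\<^bsub>G\<^esub> H) = {}))"

end

theory Submission
  imports Defs
begin

text \<open>A conjugate of \<open>g\<close> lies in a normal subgroup \<open>N\<close> only if \<open>g\<close> does, so for normal \<open>N\<close> the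
  condition \<open>N \<inter> g\<^sup>G N = \<emptyset>\<close> just says \<open>g \<notin> N\<close>. Every finite-index subgroup contains a normal
  one of finite index: the kernel of its action on its finitely many cosets.\<close>

definition coset_kernel :: "('a, 'b) monoid_scheme \<Rightarrow> 'a set \<Rightarrow> 'a set" where
  "coset_kernel G H = {g \<in> carrier G. \<forall>C\<in>rcosets\<^bsub>G\<^esub> H. C #>\<^bsub>G\<^esub> g = C}"

context group
begin

text \<open>With the two lemmas that follow, this makes right multiplication an action of
  \<open>G\<close> on the right cosets of \<open>H\<close>; the computations with
  \<open>coset_kernel\<close> rest on these action laws.\<close>

lemma r_coset_rcosets_closed:
  assumes "subgroup H G" "C \<in> rcosets H" "g \<in> carrier G"
  shows "C #> g \<in> rcosets H"
  using assms by (auto simp: RCOSETS_def coset_mult_assoc subgroup.subset)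

lemma rcosets_assoc:
  assumes "subgroup H G" "C \<in> rcosets H" "g \<in> carrier G" "h \<in> carrier G"
  shows "C #> g #> h = C #> (g \<otimes> h)"
  using assms by (simp add: coset_mult_assoc subgroup.rcosets_carrier[OF _ is_group])

lemma rcosets_mult_one:
  assumes "subgroup H G" "C \<in> rcosets H"
  shows "C #> \<one> = C"
  using assms by (simp add: subgroup.rcosets_carrier[OF _ is_group])

text \<open>\<open>H\<close> is itself one of the cosets, and its stabilizer under right
  multiplication is \<open>H\<close>.\<close>

lemma coset_kernel_subset:
  assumes "subgroup H G"
  shows "coset_kernel G H \<subseteq> H"
proof
  fix g assume "g \<in> coset_kernel G H"
  moreover have "H \<in> rcosets H"
    by (rule subgroup.subgroup_in_rcosets[OF assms is_group])
  ultimately show "g \<in> H"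
    using coset_join1[OF _ _ assms] assms by (auto simp: coset_kernel_def subgroup.subset)
qed

lemma subgroup_coset_kernel:
  assumes "subgroup H G"
  shows "subgroup (coset_kernel G H) G"
proof (rule subgroupI)
  show "coset_kernel G H \<subseteq> carrier G" by (auto simp: coset_kernel_def)
  show "coset_kernel G H \<noteq> {}"
    using rcosets_mult_one[OF assms] by (auto simp: coset_kernel_def)
next
  fix g assume g: "g \<in> coset_kernel G H"
  then have gc: "g \<in> carrier G" by (simp add: coset_kernel_def)
  have "C #> inv g = C" if C: "C \<in> rcosets H" for C
  proof -
    \<comment> \<open>Since \<open>g\<close> fixes \<open>C\<close>, it can be inserted first, and
      \<open>inv g\<close> then cancels it.\<close>
    have "C #> inv g = C #> g #> inv g" using g C by (simp add: coset_kernel_def)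
    also have "\<dots> = C" using C gc by (simp add: rcosets_assoc[OF assms] rcosets_mult_one[OF assms])
    finally show ?thesis .
  qed
  then show "inv g \<in> coset_kernel G H" using gc by (simp add: coset_kernel_def)
next
  fix g h assume "g \<in> coset_kernel G H" "h \<in> coset_kernel G H"
  then show "g \<otimes> h \<in> coset_kernel G H"
    by (simp add: coset_kernel_def rcosets_assoc[OF assms, symmetric])
qed

text \<open>The coset \<open>C #> x\<close> is again fixed by \<open>g\<close>, so
  \<open>inv x\<close> brings it straight back to \<open>C\<close>.\<close>

lemma normal_coset_kernel:
  assumes "subgroup H G"
  shows "coset_kernel G H \<lhd> G"
proof -
  have "x \<otimes> g \<otimes> inv x \<in> coset_kernel G H"
    if x: "x \<in> carrier G" and g: "g \<in> coset_kernel G H" for x g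
  proof -
    have gc: "g \<in> carrier G" using g by (simp add: coset_kernel_def)
    have "C #> (x \<otimes> g \<otimes> inv x) = C" if C: "C \<in> rcosets H" for C
    proof -
      have "C #> (x \<otimes> g \<otimes> inv x) = C #> x #> g #> inv x"
        using C x gc by (simp add: rcosets_assoc[OF assms])
      also have "\<dots> = C #> x #> inv x"
        using g r_coset_rcosets_closed[OF assms C x] by (simp add: coset_kernel_def)
      also have "\<dots> = C"
        using C x by (simp add: rcosets_assoc[OF assms] rcosets_mult_one[OF assms])
      finally show ?thesis .
    qed
    then show ?thesis using x gc by (simp add: coset_kernel_def)
  qed
  then show ?thesis using subgroup_coset_kernel[OF assms] by (simp add: normal_inv_iff)
qed

text \<open>Elements that act alike on the cosets of \<open>H\<close> differ by an element of the
  kernel, so a coset of the kernel is determined by a self-map of the finite set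
  \<open>rcosets H\<close>, and there are only finitely many such maps.\<close>

lemma finite_index_coset_kernel:
  assumes "finite_index_subgroup G H"
  shows "finite_index_subgroup G (coset_kernel G H)"
proof -
  have H: "subgroup H G" and fin: "finite (rcosets H)"
    using assms by (auto simp: finite_index_subgroup_def)
  let ?N = "coset_kernel G H"
  \<comment> \<open>The restricted abstraction fixes the value off \<open>rcosets H\<close>, which
    places \<open>act g\<close> in an extensional function space between finite sets, hence in a
    finite set.\<close>
  define act where "act g = (\<lambda>C\<in>rcosets H. C #> g)" for g
  have "act ` carrier G \<subseteq> rcosets H \<rightarrow>\<^sub>E rcosets H"
    using r_coset_rcosets_closed[OF H] by (auto simp: act_def)
  then have fin_act: "finite (act ` carrier G)"
    using fin by (meson finite_PiE finite_subset)
  have same: "?N #> g = ?N #> h"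
    if g: "g \<in> carrier G" and h: "h \<in> carrier G" and eq: "act g = act h" for g h
  proof -
    have "C #> (g \<otimes> inv h) = C" if C: "C \<in> rcosets H" for C
    proof -
      have "C #> g = C #> h" using fun_cong[OF eq, of C] C by (simp add: act_def)
      then have "C #> g #> inv h = C #> h #> inv h" by simp
      then show ?thesis
        using C g h by (simp add: rcosets_assoc[OF H] rcosets_mult_one[OF H])
    qed
    then have "g \<otimes> inv h \<in> ?N" using g h by (simp add: coset_kernel_def)
    then have "?N #> (g \<otimes> inv h) = ?N"
      using subgroup_coset_kernel[OF H] g h by (simp add: coset_join2)
    then show ?thesis
      using coset_mult_inv1 g h subgroup.subset[OF subgroup_coset_kernel[OF H]] by blast
  qed
  \<comment> \<open>\<open>inv_into\<close> picks some element acting as \<open>p\<close>; by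
    \<open>same\<close> its coset does not depend on the choice.\<close>
  have "rcosets ?N \<subseteq> (\<lambda>p. ?N #> inv_into (carrier G) act p) ` act ` carrier G"
  proof
    fix D assume "D \<in> rcosets ?N"
    then obtain g where g: "g \<in> carrier G" "D = ?N #> g" by (auto simp: RCOSETS_def)
    have "D = ?N #> inv_into (carrier G) act (act g)"
      unfolding g(2) by (rule same) (use g in \<open>auto simp: inv_into_into f_inv_into_f\<close>)
    then show "D \<in> (\<lambda>p. ?N #> inv_into (carrier G) act p) ` act ` carrier G"
      using g by blast
  qed
  then have "finite (rcosets ?N)" using fin_act by (meson finite_imageI finite_subset)
  then show ?thesis using subgroup_coset_kernel[OF H] by (simp add: finite_index_subgroup_def)
qed

lemma finite_index_subgroup_carrier: "finite_index_subgroup G (carrier G)"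
proof -
  have "rcosets (carrier G) \<subseteq> {carrier G}"
    by (auto simp: RCOSETS_def coset_join2 subgroup_self)
  then show ?thesis
    using finite_subset subgroup_self by (auto simp: finite_index_subgroup_def)
qed

text \<open>From a common element \<open>x \<otimes> g \<otimes> inv x \<otimes> m\<close> with
  \<open>m\<close> in \<open>N\<close>, cancelling \<open>m\<close> and conjugating back by
  \<open>inv x\<close> would put \<open>g\<close> into \<open>N\<close>.\<close>

lemma normal_disjoint_conjugacy_class_mult:
  assumes N: "N \<lhd> G" and g: "g \<in> carrier G" "g \<notin> N"
  shows "N \<inter> (conjugacy_class G g <#> N) = {}"
proof (rule ccontr)
  have sub: "subgroup N G" using N by (rule normal_imp_subgroup)
  assume "N \<inter> (conjugacy_class G g <#> N) \<noteq> {}"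
  then obtain x m where x: "x \<in> carrier G" and m: "m \<in> N"
    and "x \<otimes> g \<otimes> inv x \<otimes> m \<in> N"
    by (auto simp: set_mult_def conjugacy_class_def)
  then have "x \<otimes> g \<otimes> inv x \<otimes> m \<otimes> inv m \<in> N"
    using sub by (simp add: subgroup.m_closed subgroup.m_inv_closed)
  then have "x \<otimes> g \<otimes> inv x \<in> N"
    using x g subgroup.mem_carrier[OF sub m] by (simp add: m_assoc)
  then have "inv x \<otimes> (x \<otimes> g \<otimes> inv x) \<otimes> x \<in> N"
    using normal.inv_op_closed1[OF N x] by simp
  then have "g \<in> N" using x g by (simp add: m_assoc m_assoc[symmetric, of "inv x" x g])
  then show False using g by simp
qed

end

theorem corollary3p14:
  fixes G :: "('a, 'b) monoid_scheme"
  assumes "group G"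
  shows "residually_finite G \<longleftrightarrow>
    (\<exists>\<sigma>. finite_index_family G \<sigma> \<and> semi_conjugacy_separating G \<sigma>)"
proof
  interpret group G by fact
  assume "residually_finite G"
  then obtain \<sigma> where fi: "finite_index_family G \<sigma>" and sep: "separating G \<sigma>"
    by (auto simp: residually_finite_def)
  \<comment> \<open>Taking all finite-index subgroups provides both the kernels and the whole group.
    The kernels of members of \<open>\<sigma>\<close> alone could form an empty family: for trivial
    \<open>G\<close>, the empty \<open>\<sigma>\<close> is separating.\<close>
  let ?\<tau> = "Collect (finite_index_subgroup G)"
  have "\<exists>N\<in>?\<tau>. \<forall>g\<in>F - {\<one>\<^bsub>G\<^esub>}. N \<inter> (conjugacy_class G g <#>\<^bsub>G\<^esub> N) = {}"
    if F: "F \<subseteq> carrier G" "finite F" for F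
  proof (cases "F - {\<one>\<^bsub>G\<^esub>} = {}")
    \<comment> \<open>Separation says nothing about an empty set, so a witness is supplied directly:
      any finite-index subgroup will do, here the whole group.\<close>
    case True
    then show ?thesis using finite_index_subgroup_carrier by auto
  next
    case False
    moreover have "F - {\<one>\<^bsub>G\<^esub>} \<subseteq> carrier G - {\<one>\<^bsub>G\<^esub>}" "finite (F - {\<one>\<^bsub>G\<^esub>})" using F by auto
    ultimately obtain H where "H \<in> \<sigma>" and avoid: "\<forall>g\<in>F - {\<one>\<^bsub>G\<^esub>}. g \<notin> H"
      using sep unfolding separating_def by meson
    then have H: "finite_index_subgroup G H" using fi by (auto simp: finite_index_family_def)
    then have sub: "subgroup H G" by (simp add: finite_index_subgroup_def)
    have "coset_kernel G H \<inter> (conjugacy_class G g <#>\<^bsub>G\<^esub> coset_kernel G H) = {}"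
      if "g \<in> F - {\<one>\<^bsub>G\<^esub>}" for g
      using normal_disjoint_conjugacy_class_mult[OF normal_coset_kernel[OF sub]]
        coset_kernel_subset[OF sub] avoid F that by blast
    then show ?thesis using finite_index_coset_kernel[OF H] by blast
  qed
  then have "semi_conjugacy_separating G ?\<tau>" by (simp add: semi_conjugacy_separating_def)
  moreover have "finite_index_family G ?\<tau>" by (simp add: finite_index_family_def)
  ultimately show "\<exists>\<sigma>. finite_index_family G \<sigma> \<and> semi_conjugacy_separating G \<sigma>" by blast
next
  interpret group G by fact
  assume "\<exists>\<sigma>. finite_index_family G \<sigma> \<and> semi_conjugacy_separating G \<sigma>"
  then obtain \<sigma> where fi: "finite_index_family G \<sigma>" and semi: "semi_conjugacy_separating G \<sigma>"
    by blast
  \<comment> \<open>The same family separates: both the conjugating element and the factor from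
    \<open>H\<close> can be taken to be the identity, so \<open>g\<close> lies in the product of its
    class with \<open>H\<close>, which is disjoint from \<open>H\<close>.\<close>
  have "\<exists>H\<in>\<sigma>. \<forall>g\<in>F. g \<notin> H"
    if F: "F \<subseteq> carrier G - {\<one>\<^bsub>G\<^esub>}" "finite F" "F \<noteq> {}" for F
  proof -
    have "F \<subseteq> carrier G" using F by blast
    then obtain H where H: "H \<in> \<sigma>"
      and disj: "\<forall>g\<in>F - {\<one>\<^bsub>G\<^esub>}. H \<inter> (conjugacy_class G g <#>\<^bsub>G\<^esub> H) = {}"
      using semi F unfolding semi_conjugacy_separating_def by meson
    have one: "\<one>\<^bsub>G\<^esub> \<in> H"
      using fi H by (auto simp: finite_index_family_def finite_index_subgroup_def subgroup.one_closed)
    have "g \<notin> H" if g: "g \<in> F" for g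
    proof -
      have gc: "g \<in> carrier G" using g F by blast
      then have "g = \<one>\<^bsub>G\<^esub> \<otimes>\<^bsub>G\<^esub> g \<otimes>\<^bsub>G\<^esub> inv\<^bsub>G\<^esub> \<one>\<^bsub>G\<^esub>" by simp
      then have "g \<in> conjugacy_class G g" unfolding conjugacy_class_def by blast
      moreover have "g = g \<otimes>\<^bsub>G\<^esub> \<one>\<^bsub>G\<^esub>" using gc by simp
      ultimately have "g \<in> conjugacy_class G g <#>\<^bsub>G\<^esub> H"
        using one unfolding set_mult_def by blast
      then show ?thesis using disj g F by blast
    qed
    then show ?thesis using H by blast
  qed
  then have "separating G \<sigma>" by (simp add: separating_def)
  then show "residually_finite G" using fi by (auto simp: residually_finite_def)
qed

end
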